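(* For the $3$-dimensional 0-1 matrix $$P=\left( \begin{pmatrix} 0 & 1 \\ 1 & 0 \end{pmatrix}; \begin{pmatrix} 1 & 0 \\ 0 & 1 \end{pmatrix} \right),$$ $\operatorname{ex}(n,P,3)=\Omega(n^{2.5})$, $\operatorname{ex}(n,P,3)=O(n^{2.75})$, and $P$ is minimally non-$O(n^2)$.
   Context: A $3$-dimensional matrix $A$ of dimensions $a\times b\times c$ is written as the list of its layers with first coordinate $1,2,\dots,a$ (separated by semicolons), each being a $b\times c$ matrix whose entry in row $y$, column $z$ of the $x$-th layer is $A(x,y,z)$. Thus $P$ is $2\times2\times2$ with $1$-entries exactly at $(1,1,2),(1,2,1),(2,1,1),(2,2,2)$. A $d$-dimensional 0-1 matrix $A$ contains a $d$-dimensional 0-1 matrix $P$ if $A$ has a submatrix (obtained by restricting each of the $d$ coordinates to a subset of its range) of the same dimensions as $P$ that can be turned into $P$ by changing any number of $1$-entries to $0$-entries; otherwise $A$ is $P$-free. $P'$ is properly contained in $P$ if $P$ contains $P'$ and $P'\neq P$. $\operatorname{ex}(n,P,d)$ is the maximum possible number of $1$-entries in a $P$-free $d$-dimensional $n\times\dots\times n$ 0-1 matrix (taken to be $0$ if no such matrix exists). A $3$-dimensional 0-1 matrix $P$ is minimally non-$O(n^2)$ if $\operatorname{ex}(n,P,3)=\omega(n^2)$ but $\operatorname{ex}(n,P',3)=O(n^2)$ for every $3$-dimensional 0-1 matrix $P'$ properly contained in $P$. Asymptotics are for $n\to\infty$. *)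

theory Defs
  imports Complex_Main "HOL-Library.Landau_Symbols"
begin

text \<open>
  A 3-dimensional 0-1 matrix is given by its dimensions and the set of positions of its 1-entries.
  Coordinates start at 1. Since the positions lie in the index box, equality of such objects is
  equality of matrices.
\<close>

datatype mat3 = Mat3 (dim1: nat) (dim2: nat) (dim3: nat) (ones: "(nat \<times> nat \<times> nat) set")

definition is_mat3 :: "mat3 \<Rightarrow> bool" where
  "is_mat3 A \<longleftrightarrow> dim1 A \<ge> 1 \<and> dim2 A \<ge> 1 \<and> dim3 A \<ge> 1 \<and>
     ones A \<subseteq> {1..dim1 A} \<times> {1..dim2 A} \<times> {1..dim3 A}"

definition elt :: "nat set \<Rightarrow> nat \<Rightarrow> nat" \<comment> \<open>the \<open>i\<close>-th smallest element, counted from 1\<close>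
  where "elt X i = sorted_list_of_set X ! (i - 1)"

definition submatrix3 :: "mat3 \<Rightarrow> nat set \<Rightarrow> nat set \<Rightarrow> nat set \<Rightarrow> mat3" where
  "submatrix3 A X Y Z = Mat3 (card X) (card Y) (card Z)
     {(x, y, z) \<in> {1..card X} \<times> {1..card Y} \<times> {1..card Z}.
        (elt X x, elt Y y, elt Z z) \<in> ones A}"

definition contains3 :: "mat3 \<Rightarrow> mat3 \<Rightarrow> bool" where
  "contains3 A P \<longleftrightarrow>
     (\<exists>X Y Z. X \<subseteq> {1..dim1 A} \<and> Y \<subseteq> {1..dim2 A} \<and> Z \<subseteq> {1..dim3 A} \<and>
        (let B = submatrix3 A X Y Z in
           dim1 B = dim1 P \<and> dim2 B = dim2 P \<and> dim3 B = dim3 P \<and> ones P \<subseteq> ones B))"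

definition properly_contained3 :: "mat3 \<Rightarrow> mat3 \<Rightarrow> bool" where
  "properly_contained3 P' P \<longleftrightarrow> contains3 P P' \<and> P' \<noteq> P"

definition free_mats3 :: "nat \<Rightarrow> mat3 \<Rightarrow> mat3 set" where
  "free_mats3 n P =
     {A. is_mat3 A \<and> dim1 A = n \<and> dim2 A = n \<and> dim3 A = n \<and> \<not> contains3 A P}"

definition ex3 :: "nat \<Rightarrow> mat3 \<Rightarrow> nat" where
  "ex3 n P = (if free_mats3 n P = {} then 0 else Max ((\<lambda>A. card (ones A)) ` free_mats3 n P))"

definition minimally_non_O_n2 :: "mat3 \<Rightarrow> bool" where
  "minimally_non_O_n2 P \<longleftrightarrow> is_mat3 P \<and>
     (\<lambda>n. real (ex3 n P)) \<in> \<omega>(\<lambda>n. real n ^ 2) \<and>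
     (\<forall>P'. is_mat3 P' \<and> properly_contained3 P' P \<longrightarrow>
        (\<lambda>n. real (ex3 n P')) \<in> O(\<lambda>n. real n ^ 2))"

definition mat3_of_layers :: "nat list list list \<Rightarrow> mat3" where
  "mat3_of_layers L = (let a = length L; b = length (L ! 0); c = length (L ! 0 ! 0) in
     Mat3 a b c {(x, y, z) \<in> {1..a} \<times> {1..b} \<times> {1..c}. L ! (x - 1) ! (y - 1) ! (z - 1) = 1})"

definition P_mat :: mat3 where
  "P_mat = mat3_of_layers
     [[[0, 1],
       [1, 0]],
      [[1, 0],
       [0, 1]]]"

lemma P_mat_eq: "P_mat = Mat3 2 2 2 {(1,1,2), (1,2,1), (2,1,1), (2,2,2)}"
proof -
  have "{1..Suc (Suc 0)} = {1, 2::nat}" by auto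
  then show ?thesis
    unfolding P_mat_def mat3_of_layers_def Let_def list.size One_nat_def nth_Cons_0 by auto
qed

lemma finite_free_mats3: "finite (free_mats3 n P)"
proof (rule finite_subset)
  show "free_mats3 n P \<subseteq> Mat3 n n n ` Pow ({1..n} \<times> {1..n} \<times> {1..n})"
  proof
    fix A assume "A \<in> free_mats3 n P"
    then show "A \<in> Mat3 n n n ` Pow ({1..n} \<times> {1..n} \<times> {1..n})"
      by (cases A) (auto simp: free_mats3_def is_mat3_def)
  qed
qed auto

end

theory Submission
  imports Defs "HOL-Analysis.Convex"
    "HOL-Algebra.Algebraic_Closure_Type" "HOL-Library.Z2"
    "HOL-Real_Asymp.Real_Asymp"
begin

text \<open>
  Since the pattern is contained in the full \<open>2 \<times> 2 \<times> 2\<close> matrix, the box argument of Erdos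
  (double counting, applied twice) gives the upper bound. Its projection to the first two
  coordinates is a full rectangle, so \<open>G \<times> {1..n}\<close> avoids it for every rectangle-free \<open>G\<close>;
  point-line incidences over a field with \<open>2 ^ k\<close> elements provide \<open>G\<close> with about \<open>n powr (3/2)\<close>
  elements. Powers of two are dense enough for all \<open>n\<close>, so no prime gap estimate is needed.
  For minimality, reflecting two coordinates maps the pattern to itself and moves any 1-entry to any
  other, and after deleting an entry what remains is three points that are each joined to a common
  centre by a line parallel to an axis. More than \<open>6 * n ^ 2\<close> entries force one that has neighbours
  in both directions on all three of its lines.
\<close>

section \<open>Submatrices and containment\<close>

lemma elt_in:
  assumes "finite U" "i \<in> {1..card U}"
  shows "elt U i \<in> U"
  using assms nth_mem[of "i - 1" "sorted_list_of_set U"] by (auto simp: elt_def)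

lemma elt_strict_mono:
  assumes "i \<in> {1..card U}" "j \<in> {1..card U}" "i < j"
  shows "elt U i < elt U j"
  using assms strict_sorted_list_of_set[of U] unfolding elt_def
  by (intro sorted_wrt_nth_less[of "(<)"]) auto

lemma inj_on_elt: "inj_on (elt U) {1..card U}"
  by (rule inj_onI) (metis elt_strict_mono less_irrefl linorder_neqE_nat)

text \<open>Increasing enumerations compose, so a choice of indices inside a choice of indices is a
  single choice. Transitivity of containment rests on this.\<close>

lemma elt_elt:
  assumes "finite U" "V \<subseteq> {1..card U}" "i \<in> {1..card V}"
  shows "elt U (elt V i) = elt (elt U ` V) i"
proof -
  have fin: "finite V"
    using assms(2) finite_subset by blast
  \<comment> \<open>A strictly sorted list is determined by its set of elements, so strict
    sortedness identifies this list with the enumeration of the image.\<close>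
  have "sorted_wrt (<) (map (elt U) (sorted_list_of_set V))"
    unfolding sorted_wrt_map
    by (rule sorted_wrt_mono_rel[OF _ strict_sorted_list_of_set])
       (use assms fin in \<open>auto intro!: elt_strict_mono\<close>)
  then have "sorted_list_of_set (elt U ` V) = map (elt U) (sorted_list_of_set V)"
    by (intro strict_sorted_equal[OF _ strict_sorted_list_of_set]) (use fin in auto)
  then show ?thesis
    using assms by (auto simp: elt_def)
qed

lemma contains3_iff:
  "contains3 A P \<longleftrightarrow> (\<exists>U V W. U \<subseteq> {1..dim1 A} \<and> V \<subseteq> {1..dim2 A} \<and> W \<subseteq> {1..dim3 A} \<and>
     card U = dim1 P \<and> card V = dim2 P \<and> card W = dim3 P \<and>
     (\<forall>x y z. (x, y, z) \<in> ones P \<longrightarrow> x \<in> {1..card U} \<and> y \<in> {1..card V} \<and> z \<in> {1..card W} \<and>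
        (elt U x, elt V y, elt W z) \<in> ones A))"
  unfolding contains3_def submatrix3_def Let_def mat3.sel
  by (intro ex_cong1 conj_cong refl) auto

lemma contains3_trans:
  assumes "contains3 A B" "contains3 B C"
  shows "contains3 A C"
proof -
  obtain U V W where 1: "U \<subseteq> {1..dim1 A}" "V \<subseteq> {1..dim2 A}" "W \<subseteq> {1..dim3 A}"
    "card U = dim1 B" "card V = dim2 B" "card W = dim3 B"
    "\<forall>x y z. (x, y, z) \<in> ones B \<longrightarrow> (elt U x, elt V y, elt W z) \<in> ones A"
    using assms(1) unfolding contains3_iff by blast
  obtain U' V' W' where 2: "U' \<subseteq> {1..dim1 B}" "V' \<subseteq> {1..dim2 B}" "W' \<subseteq> {1..dim3 B}"
    "card U' = dim1 C" "card V' = dim2 C" "card W' = dim3 C"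
    "\<forall>x y z. (x, y, z) \<in> ones C \<longrightarrow> x \<in> {1..card U'} \<and> y \<in> {1..card V'} \<and> z \<in> {1..card W'} \<and>
        (elt U' x, elt V' y, elt W' z) \<in> ones B"
    using assms(2) unfolding contains3_iff by blast
  have fin: "finite U" "finite V" "finite W"
    using 1(1-3) finite_subset by blast+
  have sub: "elt U ` U' \<subseteq> U" "elt V ` V' \<subseteq> V" "elt W ` W' \<subseteq> W"
    using 1(4-6) 2(1-3) fin by (auto intro!: elt_in)
  have card: "card (elt U ` U') = card U'" "card (elt V ` V') = card V'" "card (elt W ` W') = card W'"
    using 1 2 by (metis card_image inj_on_elt inj_on_subset)+
  show ?thesis
    unfolding contains3_iff
  proof (intro exI conjI)
    show "\<forall>x y z. (x, y, z) \<in> ones C \<longrightarrow> x \<in> {1..card (elt U ` U')} \<and> y \<in> {1..card (elt V ` V')} \<and>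
        z \<in> {1..card (elt W ` W')} \<and>
        (elt (elt U ` U') x, elt (elt V ` V') y, elt (elt W ` W') z) \<in> ones A"
      unfolding card
    proof clarify
      fix x y z assume "(x, y, z) \<in> ones C"
      then have *: "x \<in> {1..card U'}" "y \<in> {1..card V'}" "z \<in> {1..card W'}"
        "(elt U' x, elt V' y, elt W' z) \<in> ones B"
        using 2(7) by auto
      then show "x \<in> {1..card U'} \<and> y \<in> {1..card V'} \<and> z \<in> {1..card W'} \<and>
        (elt (elt U ` U') x, elt (elt V ` V') y, elt (elt W ` W') z) \<in> ones A"
        using 1(4-7) 2(1-3) fin by (auto simp flip: elt_elt)
    qed
  qed (use sub card 1 2 in auto)
qed

text \<open>A two-element index set is an ordered pair, and the conditional expressions are its
  enumeration at 1 and 2. The set \<open>S\<close> is kept general to cover the pattern as well as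
  its one-entry deletions.\<close>

lemma contains3_222_iff:
  assumes "S \<subseteq> {1, 2} \<times> {1, 2} \<times> {1, 2}"
  shows "contains3 A (Mat3 2 2 2 S) \<longleftrightarrow> (\<exists>x x' y y' z z'.
     x < x' \<and> y < y' \<and> z < z' \<and> {x, x'} \<subseteq> {1..dim1 A} \<and> {y, y'} \<subseteq> {1..dim2 A} \<and>
     {z, z'} \<subseteq> {1..dim3 A} \<and>
     (\<forall>i j k. (i, j, k) \<in> S \<longrightarrow> (if i = 1 then x else x', if j = 1 then y else y', if k = 1 then z else z')
        \<in> ones A))"
    (is "?L \<longleftrightarrow> ?R")
proof
  assume ?L
  then obtain U V W where *: "U \<subseteq> {1..dim1 A}" "V \<subseteq> {1..dim2 A}" "W \<subseteq> {1..dim3 A}"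
    "card U = 2" "card V = 2" "card W = 2"
    "\<forall>x y z. (x, y, z) \<in> S \<longrightarrow> (elt U x, elt V y, elt W z) \<in> ones A"
    unfolding contains3_iff mat3.sel by blast
  have lt: "elt T 1 < elt T 2" if "card T = 2" for T
    using that by (intro elt_strict_mono) auto
  have sub: "{elt T 1, elt T 2} \<subseteq> M" if "card T = 2" "T \<subseteq> M" for T M
    using that elt_in[of T 1] elt_in[of T 2] card_ge_0_finite[of T] by auto
  have "(if i = 1 then elt T 1 else elt T 2) = elt T i" if "i \<in> {1, 2}" for i T
    using that by auto
  then have ent: "\<forall>i j k. (i, j, k) \<in> S \<longrightarrow> (if i = 1 then elt U 1 else elt U 2, if j = 1 then elt V 1 else elt V 2,
      if k = 1 then elt W 1 else elt W 2) \<in> ones A"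
    using *(7) assms by fastforce
  show ?R
    by (intro exI[of _ "elt U 1"] exI[of _ "elt U 2"] exI[of _ "elt V 1"] exI[of _ "elt V 2"]
        exI[of _ "elt W 1"] exI[of _ "elt W 2"] conjI lt sub ent *)
next
  assume ?R
  then obtain x x' y y' z z' where *: "x < x'" "y < y'" "z < z'" "{x, x'} \<subseteq> {1..dim1 A}"
     "{y, y'} \<subseteq> {1..dim2 A}" "{z, z'} \<subseteq> {1..dim3 A}"
     "\<forall>i j k. (i, j, k) \<in> S \<longrightarrow> (if i = 1 then x else x', if j = 1 then y else y', if k = 1 then z else z')
        \<in> ones A"
    by (elim exE conjE) (rule that)
  have elt: "elt {a, a'} i = (if i = 1 then a else a')" if "a < a'" "i \<in> {1, 2}" for a a' i :: nat
  proof -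
    have "sorted_list_of_set {a, a'} = [a, a']"
      using that by (intro strict_sorted_equal[OF _ strict_sorted_list_of_set]) auto
    then show ?thesis
      using that by (auto simp: elt_def)
  qed
  show ?L
    unfolding contains3_iff
  proof (intro exI conjI)
    show "\<forall>i j k. (i, j, k) \<in> ones (Mat3 2 2 2 S) \<longrightarrow> i \<in> {1..card {x, x'}} \<and> j \<in> {1..card {y, y'}} \<and>
        k \<in> {1..card {z, z'}} \<and> (elt {x, x'} i, elt {y, y'} j, elt {z, z'} k) \<in> ones A"
    proof clarify
      fix i j k assume "(i, j, k) \<in> ones (Mat3 2 2 2 S)"
      then have "(i, j, k) \<in> S" "i \<in> {1, 2}" "j \<in> {1, 2}" "k \<in> {1, 2}"
        using assms by auto
      moreover from this have "(elt {x, x'} i, elt {y, y'} j, elt {z, z'} k) \<in> ones A"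
        using *(7) elt[OF *(1)] elt[OF *(2)] elt[OF *(3)] by fastforce
      ultimately show "i \<in> {1..card {x, x'}} \<and> j \<in> {1..card {y, y'}} \<and>
        k \<in> {1..card {z, z'}} \<and> (elt {x, x'} i, elt {y, y'} j, elt {z, z'} k) \<in> ones A"
        using *(1-3) by auto
    qed
  qed (use * in auto)
qed

text \<open>Each of the six values occurs in one of the four entries, so the range conditions follow
  from \<open>is_mat3 A\<close>.\<close>

lemma contains3_P_mat_iff:
  assumes "is_mat3 A"
  shows "contains3 A P_mat \<longleftrightarrow> (\<exists>x x' y y' z z'. x < x' \<and> y < y' \<and> z < z' \<and>
    (x, y, z') \<in> ones A \<and> (x, y', z) \<in> ones A \<and> (x', y, z) \<in> ones A \<and> (x', y', z') \<in> ones A)"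
proof -
  define S :: "(nat \<times> nat \<times> nat) set" where "S = {(1, 1, 2), (1, 2, 1), (2, 1, 1), (2, 2, 2)}"
  have all: "(\<forall>i j k. (i, j, k) \<in> S \<longrightarrow> Q i j k) \<longleftrightarrow> Q 1 1 2 \<and> Q 1 2 1 \<and> Q 2 1 1 \<and> Q 2 2 2"
    for Q :: "nat \<Rightarrow> nat \<Rightarrow> nat \<Rightarrow> bool"
    unfolding S_def by auto
  have rng: "x \<in> {1..dim1 A} \<and> y \<in> {1..dim2 A} \<and> z \<in> {1..dim3 A}" if "(x, y, z) \<in> ones A" for x y z
    using that assms unfolding is_mat3_def by auto
  have "S \<subseteq> {1, 2} \<times> {1, 2} \<times> {1, 2}"
    by (auto simp: S_def)
  from contains3_222_iff[OF this] show ?thesis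
    unfolding P_mat_eq S_def[symmetric] all
    by (rule trans, intro ex_cong1) (use rng in auto)
qed

section \<open>From single matrices to the extremal function\<close>

lemma ex3_le:
  assumes "\<And>A. A \<in> free_mats3 n P \<Longrightarrow> real (card (ones A)) \<le> C" "0 \<le> C"
  shows "real (ex3 n P) \<le> C"
proof (cases "free_mats3 n P = {}")
  case False
  then have "ex3 n P \<in> (\<lambda>A. card (ones A)) ` free_mats3 n P"
    unfolding ex3_def using finite_free_mats3 by (auto intro!: Max_in)
  then show ?thesis
    using assms by auto
\<comment> \<open>Without any free matrix, as for \<open>n = 0\<close>, the value of
  \<open>ex3\<close> is 0 by convention; \<open>0 \<le> C\<close> covers this case.\<close>
qed (use assms in \<open>simp add: ex3_def\<close>)

lemma ex3_ge:
  assumes "A \<in> free_mats3 n P"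
  shows "card (ones A) \<le> ex3 n P"
  using assms finite_free_mats3 unfolding ex3_def by (auto intro!: Max_ge)

section \<open>The upper bound\<close>

text \<open>Counting the pairs \<open>(u, v), (u', v)\<close> of edges with a common endpoint \<open>v\<close> in two ways.\<close>

lemma bipartite_edges_bound:
  fixes U :: "'a set" and V :: "'b set" and t :: real
  assumes "finite U" "finite V" and E: "E \<subseteq> U \<times> V" and "0 \<le> t"
    and codeg: "\<And>u u'. u \<in> U \<Longrightarrow> u' \<in> U \<Longrightarrow> u \<noteq> u' \<Longrightarrow> real (card {v. (u, v) \<in> E \<and> (u', v) \<in> E}) \<le> t"
  shows "real (card E) \<le> card V + sqrt (t * card V) * card U"
proof -
  define I where "I u v = (of_bool ((u, v) \<in> E) :: real)" for u v
  have c: "(\<Sum>v\<in>V. I u v * I u' v) = real (card {v. (u, v) \<in> E \<and> (u', v) \<in> E})" for u u'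
  proof -
    have "{v. (u, v) \<in> E \<and> (u', v) \<in> E} = {v \<in> V. (u, v) \<in> E \<and> (u', v) \<in> E}"
      using E by auto
    then show ?thesis
      using \<open>finite V\<close> by (simp add: I_def Int_def flip: of_bool_conj)
  qed
  have "real (card E) = (\<Sum>p\<in>U\<times>V. of_bool (p \<in> E))"
    using assms by (simp add: of_bool_def sum.If_cases Int_absorb1)
  also have "\<dots> = (\<Sum>u\<in>U. \<Sum>v\<in>V. I u v)"
    by (simp add: sum.cartesian_product I_def case_prod_unfold)
  finally have e: "real (card E) = (\<Sum>u\<in>U. \<Sum>v\<in>V. I u v)" .
  also have "\<dots> = (\<Sum>v\<in>V. \<Sum>u\<in>U. I u v)"
    by (rule sum.swap)
  \<comment> \<open>Cauchy-Schwarz for the degrees of the vertices in \<open>V\<close>.\<close>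
  finally have "(card E)\<^sup>2 \<le> (\<Sum>v\<in>V. (\<Sum>u\<in>U. I u v)\<^sup>2) * card V"
    using sum_squared_le_sum_of_squares[of "\<lambda>v. \<Sum>u\<in>U. I u v" V] \<open>finite V\<close> by simp
  also have "(\<Sum>v\<in>V. (\<Sum>u\<in>U. I u v)\<^sup>2) = (\<Sum>u\<in>U. \<Sum>u'\<in>U. \<Sum>v\<in>V. I u v * I u' v)"
    unfolding power2_eq_square sum_product
    by (subst sum.swap, rule sum.cong[OF refl], rule sum.swap)
  \<comment> \<open>The diagonal terms are the degrees in \<open>U\<close>, which add up to
    \<open>card E\<close>; all other terms are codegrees, at most \<open>t\<close>.\<close>
  also have "\<dots> \<le> (\<Sum>u\<in>U. \<Sum>u'\<in>U. (if u = u' then \<Sum>v\<in>V. I u v else 0) + t)"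
  proof (intro sum_mono)
    fix u u' assume "u \<in> U" "u' \<in> U"
    then show "(\<Sum>v\<in>V. I u v * I u' v) \<le> (if u = u' then \<Sum>v\<in>V. I u v else 0) + t"
      using codeg[of u u'] \<open>0 \<le> t\<close>
      by (cases "u = u'") (simp add: I_def flip: of_bool_conj, simp add: c)
  qed
  also have "\<dots> = card E + t * (card U)\<^sup>2"
    using \<open>finite U\<close> by (simp add: sum.distrib e power2_eq_square)
  finally have main: "(real (card E))\<^sup>2 \<le> (card E + t * (card U)\<^sup>2) * card V"
    by (simp add: mult_right_mono)
  \<comment> \<open>The quadratic inequality is not solved explicitly: if the bound fails,
    multiplying \<open>card E - card V > s\<close> and \<open>card E > s\<close> contradicts
    \<open>main\<close>.\<close>
  show ?thesis
  proof (rule ccontr)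
    define s where "s = sqrt (t * card V) * card U"
    have s: "0 \<le> s" "s\<^sup>2 = t * (card U)\<^sup>2 * card V"
      using \<open>0 \<le> t\<close> by (simp_all add: s_def power_mult_distrib)
    assume "\<not> ?thesis"
    then have "s < real (card E) - card V" "s < real (card E)"
      by (auto simp: s_def)
    then have "s * s < (real (card E) - card V) * card E"
      using s(1) by (intro mult_strict_mono') auto
    then show False
      using main s(2) by (simp add: power2_eq_square algebra_simps)
  qed
qed

text \<open>For \<open>G\<close> read as the edge set of a bipartite graph, this excludes the
  complete bipartite graph with two vertices on each side.\<close>

definition rectangle_free :: "(nat \<times> nat) set \<Rightarrow> bool" where
  "rectangle_free G \<longleftrightarrow> \<not> (\<exists>y y' z z'. y < y' \<and> z < z' \<and> {y, y'} \<times> {z, z'} \<subseteq> G)"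

text \<open>Two distinct rows share at most one column, so the codegree bound applies with
  \<open>t = 1\<close>: the Kovari-Sos-Turan argument.\<close>

lemma card_rectangle_free_le:
  assumes "G \<subseteq> {1..n} \<times> {1..n}" "rectangle_free G"
  shows "real (card G) \<le> n + sqrt n * n"
proof -
  have "card {v. (u, v) \<in> G \<and> (u', v) \<in> G} \<le> 1" if "u \<noteq> u'" for u u'
  proof (rule ccontr)
    assume *: "\<not> ?thesis"
    then obtain v v' where "v \<noteq> v'" "{(u, v), (u', v), (u, v'), (u', v')} \<subseteq> G"
      using card_le_Suc0_iff_eq[of "{v. (u, v) \<in> G \<and> (u', v) \<in> G}"]
      by (metis (mono_tags, lifting) One_nat_def card.infinite empty_subsetI insert_subset
          mem_Collect_eq zero_le)
    then have "{min u u', max u u'} \<times> {min v v', max v v'} \<subseteq> G"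
      by (auto simp: min_def max_def)
    moreover have "min u u' < max u u'" "min v v' < max v v'"
      using that \<open>v \<noteq> v'\<close> by auto
    ultimately show False
      using assms(2) unfolding rectangle_free_def by blast
  qed
  then have "real (card G) \<le> real (card {1..n}) + sqrt (1 * real (card {1..n})) * real (card {1..n})"
    using assms(1) by (intro bipartite_edges_bound) auto
  then show ?thesis
    by simp
qed

text \<open>If every two \<open>x\<close>-layers meet in a rectangle-free set, then \<open>bipartite_edges_bound\<close> applies
  to the bipartite graph between layers \<open>x\<close> and positions \<open>(y, z)\<close>.\<close>

lemma ex3_P_mat_le:
  assumes "n \<ge> 1"
  shows "real (ex3 n P_mat) \<le> 3 * real n powr (11/4)"
proof (rule ex3_le)
  fix A assume A: "A \<in> free_mats3 n P_mat"
  define V where "V = {1..n} \<times> {1..n}"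
  have sub: "ones A \<subseteq> {1..n} \<times> V"
    using A by (auto simp: free_mats3_def is_mat3_def V_def)
  define t where "t = n + sqrt n * n"
  have "rectangle_free {v. (u, v) \<in> ones A \<and> (u', v) \<in> ones A}" if "u < u'" for u u'
    unfolding rectangle_free_def
  proof clarify
    fix y y' z z' assume "y < y'" "z < z'"
      and "{y, y'} \<times> {z, z'} \<subseteq> {v. (u, v) \<in> ones A \<and> (u', v) \<in> ones A}"
    \<comment> \<open>A rectangle common to two layers is a full box; only the four corners required
      by the pattern are kept.\<close>
    then have "(u, y, z') \<in> ones A" "(u, y', z) \<in> ones A" "(u', y, z) \<in> ones A" "(u', y', z') \<in> ones A"
      by auto
    then have "contains3 A P_mat"
      using that \<open>y < y'\<close> \<open>z < z'\<close> A contains3_P_mat_iff[of A] unfolding free_mats3_def by blast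
    then show False
      using A by (simp add: free_mats3_def)
  qed
  then have "rectangle_free {v. (u, v) \<in> ones A \<and> (u', v) \<in> ones A}" if "u \<noteq> u'" for u u'
    using that by (metis (no_types, lifting) Collect_cong linorder_neqE_nat)
  then have "real (card {v. (u, v) \<in> ones A \<and> (u', v) \<in> ones A}) \<le> t" if "u \<noteq> u'" for u u'
    unfolding t_def using that sub by (intro card_rectangle_free_le) (auto simp: V_def)
  then have "real (card (ones A)) \<le> card V + sqrt (t * card V) * card {1..n}"
    using sub by (intro bipartite_edges_bound) (auto simp: V_def t_def)
  also have "\<dots> = real n ^ 2 + sqrt t * real n ^ 2"
    by (simp add: V_def real_sqrt_mult power2_eq_square)
  \<comment> \<open>Since \<open>t\<close> is at most \<open>2 * n powr (3/2)\<close>, its root is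
    of order \<open>n powr (3/4)\<close>, and 3/4 + 2 = 11/4.\<close>
  also have "\<dots> \<le> real n powr (11/4) + 2 * real n powr (11/4)"
  proof (rule add_mono)
    have n: "real n \<ge> 1"
      using assms by simp
    have "real n ^ 2 = real n powr 2"
      using n by simp
    also have "\<dots> \<le> real n powr (11/4)"
      using n by (intro powr_mono) auto
    finally show "real n ^ 2 \<le> real n powr (11/4)" .
    have "t \<le> real n powr (3/2) + real n powr (3/2)"
      unfolding t_def
    proof (rule add_mono)
      show "real n \<le> real n powr (3/2)"
        using n powr_mono[of 1 "3/2" "real n"] by simp
      show "sqrt n * n \<le> real n powr (3/2)"
        using n powr_add[of "real n" "1/2" 1] by (simp add: powr_half_sqrt)
    qed
    also have "\<dots> \<le> (2 * real n powr (3/4))\<^sup>2"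
      using n by (simp add: power_mult_distrib power2_eq_square flip: powr_add)
    finally have "sqrt t \<le> 2 * real n powr (3/4)"
      by (rule real_le_lsqrt[rotated]) auto
    then have "sqrt t * real n ^ 2 \<le> 2 * real n powr (3/4) * real n ^ 2"
      by (rule mult_right_mono) auto
    also have "\<dots> = 2 * real n powr (11/4)"
      using n powr_add[of "real n" "3/4" 2] by simp
    finally show "sqrt t * real n ^ 2 \<le> 2 * real n powr (11/4)" .
  qed
  finally show "real (card (ones A)) \<le> 3 * real n powr (11/4)"
    by simp
qed auto

section \<open>Finite fields and the lower bound\<close>

text \<open>The polynomial splits into linear factors, and a repeated factor would make its root a
  zero of the derivative too. Hence the multiset of roots has no repetitions.\<close>

lemma card_roots_squarefree:
  fixes p :: "'a :: alg_closed_field poly"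
  assumes "p \<noteq> 0" and sep: "\<And>x. poly p x = 0 \<Longrightarrow> poly (pderiv p) x \<noteq> 0"
  shows "card {x. poly p x = 0} = Polynomial.degree p"
proof -
  obtain R where R: "size R = Polynomial.degree p" "p = smult (Polynomial.lead_coeff p) (\<Prod>x\<in>#R. [:-x, 1:])"
    using alg_closed_imp_factorization[OF assms(1)] by blast
  have "count R x \<le> 1" for x
  proof (rule ccontr)
    assume "\<not> ?thesis"
    then have "{#x, x#} \<subseteq># R"
      by (auto simp: subseteq_mset_def)
    then obtain S where "R = {#x, x#} + S"
      using mset_subset_eq_exists_conv by blast
    then have "p = [:-x, 1:] * ([:-x, 1:] * smult (Polynomial.lead_coeff p) (\<Prod>x\<in>#S. [:-x, 1:]))"
      using R(2) by simp
    then obtain q where "p = [:-x, 1:] * ([:-x, 1:] * q)"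
      by blast
    then have "poly p x = 0" "poly (pderiv p) x = 0"
      by (simp_all add: pderiv_mult del: mult_pCons_left)
    then show False
      using sep by blast
  qed
  then have "size R = card (set_mset R)"
    unfolding size_multiset_overloaded_eq
    by (metis (no_types, lifting) One_nat_def card_eq_sum count_eq_zero_iff le_Suc_eq le_zero_eq sum.cong)
  moreover have "proots (\<Prod>x\<in>#S. [:-x, 1:]) = S" for S :: "'a multiset"
  proof (induction S)
    case (add x S)
    have "(\<Prod>x\<in>#S. [:-x, 1:]) \<noteq> 0"
      by (auto simp: prod_mset_zero_iff)
    then have "proots ([:-x, 1:] * (\<Prod>x\<in>#S. [:-x, 1:])) = proots [:-x, 1:] + S"
      by (subst proots_mult) (simp_all add: add)
    then show ?case
      by (simp del: mult_pCons_left)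
  qed simp
  then have "proots p = R"
    using assms(1) by (subst R(2)) simp
  then have "set_mset R = {x. poly p x = 0}"
    using assms(1) by (metis set_count_proots)
  ultimately show ?thesis
    using R(1) by simp
qed

text \<open>For positive \<open>k\<close>, the set consists of the roots of x^q - x with q = 2^k in
  the closure of the two-element field. Products and differences are the operations that the
  incidence relation uses.\<close>

lemma finite_subfield_alg_closure_bit:
  obtains F :: "bit alg_closure set" where "card F = 2 ^ k"
    "\<forall>x\<in>F. \<forall>y\<in>F. x * y \<in> F" "\<forall>x\<in>F. \<forall>y\<in>F. x - y \<in> F"
proof (cases "k = 0")
  \<comment> \<open>Here x^q - x is the zero polynomial, so a one-element set is given
    directly.\<close>
  case True
  then show ?thesis
    by (intro that[of "{0}"]) auto
next
  case False
  have ch_bit: "CHAR(bit) = 2"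
  proof (rule CHAR_eqI)
    have "of_nat n = (of_bool (odd n) :: bit)" for n
      by (induction n) auto
    then show "2 dvd n" if "of_nat n = (0 :: bit)" for n
      using that by auto
  qed simp
  then have ch: "CHAR(bit alg_closure) = 2"
    by simp
  have two: "(2 :: bit alg_closure) = 0"
    using of_nat_CHAR[where 'a = "bit alg_closure"] unfolding ch by simp
  define q :: nat where "q = 2 ^ k"
  have "q > 1"
    using False one_less_power[of "2::nat" k] by (simp add: q_def)
  define p :: "bit alg_closure poly" where "p = Polynomial.monom 1 q - Polynomial.monom 1 1"
  have deg: "Polynomial.degree p = q"
    using \<open>q > 1\<close> degree_add_eq_left[of "- Polynomial.monom 1 1" "Polynomial.monom (1 :: bit alg_closure) q"]
    by (simp add: p_def degree_monom_eq)
  have add: "(x + y) ^ q = x ^ q + y ^ q" for x y :: "bit alg_closure"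
    by (rule freshmans_dream'[of _ k]) (auto simp: ch_bit q_def)
  \<comment> \<open>In characteristic 2 subtraction is addition, so additivity of the q-th power
    also yields closure under differences.\<close>
  have minus: "x - y = x + y" for x y :: "bit alg_closure"
  proof -
    have "(x + y) - (x - y) = 2 * y"
      by (simp only: mult_2) simp
    also have "\<dots> = 0"
      by (simp only: two mult_zero_left)
    finally show ?thesis
      by (metis right_minus_eq)
  qed
  \<comment> \<open>As q is even, x^q has derivative 0. The derivative of \<open>p\<close> thus
    never vanishes, and \<open>p\<close> has exactly q distinct roots.\<close>
  have "pderiv p = - 1"
    using two False by (simp add: p_def pderiv_diff pderiv_monom q_def of_nat_power)
  then have "card {x. poly p x = 0} = q"
    using deg \<open>q > 1\<close> by (subst card_roots_squarefree) auto
  moreover have "poly p x = 0 \<longleftrightarrow> x ^ q = x" for x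
    by (simp add: p_def poly_monom)
  moreover have "(x - y) ^ q = x ^ q - y ^ q" for x y :: "bit alg_closure"
    by (simp only: minus add)
  ultimately show ?thesis
    by (intro that[of "{x. x ^ q = x}"]) (auto simp: power_mult_distrib q_def)
qed

text \<open>Point-line incidences of the affine plane over a field with \<open>2 ^ k\<close> elements: the point
  \<open>(a, b)\<close> lies on the line \<open>d = a * c - b\<close> with parameters \<open>(c, d)\<close>.\<close>

lemma rectangle_free_large:
  obtains G where "G \<subseteq> {1..4 ^ k} \<times> {1..4 ^ k}" "rectangle_free G" "card G = 8 ^ k"
proof -
  obtain F :: "bit alg_closure set" where F: "card F = 2 ^ k"
    "\<forall>x\<in>F. \<forall>y\<in>F. x * y \<in> F" "\<forall>x\<in>F. \<forall>y\<in>F. x - y \<in> F"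
    using finite_subfield_alg_closure_bit[of k] by blast
  have fin: "finite F"
    using F(1) by (metis card.infinite power_not_zero zero_neq_numeral)
  have "card (F \<times> F) = card {1..(4::nat) ^ k}"
    by (simp add: card_cartesian_product F(1) flip: power_mult_distrib)
  then obtain h where h: "bij_betw h (F \<times> F) {1..(4::nat) ^ k}"
    using fin finite_same_card_bij[of "F \<times> F"] by blast
  then have h_eq: "h x = h y \<longleftrightarrow> x = y" if "x \<in> F \<times> F" "y \<in> F \<times> F" for x y
    using that by (auto simp: bij_betw_def inj_on_eq_iff)
  \<comment> \<open>The numbering \<open>h\<close> serves for points and lines alike. A point and
    the slope parameter of a line through it determine the line, which gives
    \<open>(2 ^ k) ^ 3\<close> incidences.\<close>
  define g where "g = (\<lambda>(a, b, c). (h (a, b), h (c, a * c - b)))"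
  have "inj_on g (F \<times> F \<times> F)"
    by (rule inj_onI) (auto simp: g_def h_eq F)
  then have "card (g ` (F \<times> F \<times> F)) = 8 ^ k"
    by (simp add: card_image card_cartesian_product F(1) flip: power_mult_distrib)
  moreover have "g ` (F \<times> F \<times> F) \<subseteq> {1..4 ^ k} \<times> {1..4 ^ k}"
    using h F by (auto simp: g_def bij_betw_def)
  moreover have "rectangle_free (g ` (F \<times> F \<times> F))"
    unfolding rectangle_free_def
  proof clarify
    fix u u' v v' assume *: "u < u'" "v < v'" "{u, u'} \<times> {v, v'} \<subseteq> g ` (F \<times> F \<times> F)"
    have dest: "\<exists>a\<in>F. \<exists>b\<in>F. \<exists>c\<in>F. x = h (a, b) \<and> y = h (c, a * c - b)"
      if "(x, y) \<in> g ` (F \<times> F \<times> F)" for x y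
      using that by (auto simp: g_def)
    have incident: "d = a * c - b" if "(h (a, b), h (c, d)) \<in> g ` (F \<times> F \<times> F)"
      "a \<in> F" "b \<in> F" "c \<in> F" "d \<in> F" for a b c d
      using dest[OF that(1)] that(2-) F by (auto simp: h_eq)
    obtain a b c where 1: "a \<in> F" "b \<in> F" "c \<in> F" "u = h (a, b)" "v = h (c, a * c - b)"
      using dest[of u v] *(3) by blast
    obtain a' b' c' where 2: "a' \<in> F" "b' \<in> F" "c' \<in> F" "u' = h (a', b')" "v' = h (c', a' * c' - b')"
      using dest[of u' v'] *(3) by blast
    have E1: "a' * c' - b' = a * c' - b"
      by (rule incident) (use 1 2 *(3) F in auto)
    have E2: "a * c - b = a' * c - b'"
      by (rule incident) (use 1 2 *(3) F in auto)
    \<comment> \<open>Two points on two common lines: subtracting the equations gives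
      \<open>(a - a') * (c - c') = 0\<close>, so either the points or the lines coincide.\<close>
    have "a * c - a' * c = b - b'" "a * c' - a' * c' = b - b'"
      using E1 E2 by (simp_all add: algebra_simps)
    then have "(a - a') * (c - c') = 0"
      by (simp add: left_diff_distrib right_diff_distrib)
    then consider "a = a'" | "c = c'"
      by auto
    then have "u = u' \<or> v = v'"
    proof cases
      case 1
      then show ?thesis
        using E2 \<open>u = h (a, b)\<close> \<open>u' = h (a', b')\<close> by simp
    next
      case 2
      then show ?thesis
        using E1 \<open>v = h (c, a * c - b)\<close> \<open>v' = h (c', a' * c' - b')\<close> by simp
    qed
    then show False
      using * by auto
  qed
  ultimately show ?thesis
    using that by blast
qed

section \<open>Pattern-free matrices from rectangle-free sets\<close>

lemma ex3_P_mat_ge: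
  assumes "G \<subseteq> {1..n} \<times> {1..n}" "rectangle_free G" "n \<ge> 1"
  shows "card G * n \<le> ex3 n P_mat"
proof -
  define f where "f = (\<lambda>((x, y), z). (x, y, z) :: nat \<times> nat \<times> nat)"
  define A where "A = Mat3 n n n (f ` (G \<times> {1..n}))"
  have "inj_on f (G \<times> {1..n})"
    by (auto simp: f_def inj_on_def)
  then have "card (ones A) = card G * n"
    by (simp add: A_def card_image card_cartesian_product)
  moreover have mat: "is_mat3 A"
    using assms(1,3) by (auto simp: is_mat3_def A_def f_def)
  moreover have "\<not> contains3 A P_mat"
  proof
    assume "contains3 A P_mat"
    then obtain x x' y y' z z' where "x < x'" "y < y'" and
      mem: "(x, y, z') \<in> ones A" "(x, y', z) \<in> ones A" "(x', y, z) \<in> ones A" "(x', y', z') \<in> ones A"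
      using contains3_P_mat_iff[OF mat] by blast
    have "(a, b) \<in> G" if "(a, b, c) \<in> ones A" for a b c
      using that by (auto simp: A_def f_def)
    \<comment> \<open>The four entries of the pattern project to the four different corners.\<close>
    then have "{x, x'} \<times> {y, y'} \<subseteq> G"
      using mem by blast
    then show False
      using assms(2) \<open>x < x'\<close> \<open>y < y'\<close> unfolding rectangle_free_def by blast
  qed
  ultimately show ?thesis
    using ex3_ge[of A n P_mat] by (simp add: free_mats3_def A_def)
qed

text \<open>Take the largest power of 4 up to \<open>n\<close>. Passing to the next power costs a
  factor of at most 4 in \<open>n\<close>, hence \<open>4 powr (3/2) = 8\<close> in the
  bound.\<close>

lemma powr_le_ex3_P_mat:
  assumes "n \<ge> 1"
  shows "real n powr (5/2) \<le> 8 * real (ex3 n P_mat)"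
proof -
  obtain k where k: "4 ^ k \<le> n" "n < 4 ^ (k + 1)"
    using ex_power_ivl1[of 4 n] assms by auto
  obtain G where G: "G \<subseteq> {1..4 ^ k} \<times> {1..4 ^ k}" "rectangle_free G" "card G = 8 ^ k"
    using rectangle_free_large[of k] .
  have "card G * n \<le> ex3 n P_mat"
    using G k assms by (intro ex3_P_mat_ge) auto
  then have ex: "8 ^ k * real n \<le> ex3 n P_mat"
    unfolding G(3) by (simp flip: of_nat_le_iff[where 'a = real])
  have "real n powr (5/2) = real n powr (3/2) * n"
    using assms powr_add[of "real n" "3/2" 1] by simp
  also have "real n powr (3/2) \<le> (4 ^ (k + 1)) powr (3/2)"
  proof (rule powr_mono2)
    show "real n \<le> 4 ^ (k + 1)"
      using k(2) by (metis less_imp_le of_nat_le_iff of_nat_numeral of_nat_power)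
  qed auto
  also have "(4 ^ (k + 1) :: real) = (2 ^ (k + 1)) powr 2"
    by (simp add: power2_eq_square flip: power_mult_distrib)
  also have "\<dots> powr (3/2) = (2 ^ (k + 1)) powr 3"
    by (simp only: powr_powr) simp
  also have "\<dots> = 8 * 8 ^ k"
    by (simp add: power3_eq_cube power_mult_distrib flip: power_mult_distrib)
  finally have "real n powr (5/2) \<le> 8 * (8 ^ k * real n)"
    by (simp add: mult_right_mono)
  then show ?thesis
    using ex by linarith
qed

section \<open>Minimality\<close>

text \<open>An entry lacking a neighbour in one of the six axis directions is the extreme entry of
  its line in that direction. Each axis has \<open>n ^ 2\<close> lines, so at most
  \<open>6 * n ^ 2\<close> entries are bad.\<close>

lemma entry_with_neighbours:
  assumes "A \<subseteq> {1..n} \<times> {1..n} \<times> {1..n}" "card A > 6 * n ^ 2"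
  obtains a b c x x' y y' z z' where "x < a" "a < x'" "y < b" "b < y'" "z < c" "c < (z' :: nat)"
    "{(x, b, c), (x', b, c), (a, y, c), (a, y', c), (a, b, z), (a, b, z')} \<subseteq> A"
proof -
  define B1 where "B1 = {(a, b, c) \<in> A. \<forall>x<a. (x, b, c) \<notin> A}"
  define B2 where "B2 = {(a, b, c) \<in> A. \<forall>x>a. (x, b, c) \<notin> A}"
  define B3 where "B3 = {(a, b, c) \<in> A. \<forall>y<b. (a, y, c) \<notin> A}"
  define B4 where "B4 = {(a, b, c) \<in> A. \<forall>y>b. (a, y, c) \<notin> A}"
  define B5 where "B5 = {(a, b, c) \<in> A. \<forall>z<c. (a, b, z) \<notin> A}"
  define B6 where "B6 = {(a, b, c) \<in> A. \<forall>z>c. (a, b, z) \<notin> A}"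
  note B_defs = B1_def B2_def B3_def B4_def B5_def B6_def
  \<comment> \<open>The map \<open>f\<close> will forget the coordinate along the line; it is
    injective because a line has only one extreme entry in a given direction.\<close>
  have le: "card B \<le> n ^ 2" if "inj_on f B" "f ` B \<subseteq> {1..n} \<times> {1..n}"
    for B and f :: "nat \<times> nat \<times> nat \<Rightarrow> nat \<times> nat"
    using card_inj_on_le[OF that] by (simp add: power2_eq_square)
  have "card B1 \<le> n ^ 2"
  proof (rule le[of "\<lambda>(a, b, c). (b, c)"])
    show "inj_on (\<lambda>(a, b, c). (b, c)) B1"
      by (auto simp: inj_on_def B1_def) (metis linorder_neqE_nat)
  qed (use assms(1) in \<open>auto simp: B1_def\<close>)
  moreover have "card B2 \<le> n ^ 2"
  proof (rule le[of "\<lambda>(a, b, c). (b, c)"])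
    show "inj_on (\<lambda>(a, b, c). (b, c)) B2"
      by (auto simp: inj_on_def B2_def) (metis linorder_neqE_nat)
  qed (use assms(1) in \<open>auto simp: B2_def\<close>)
  moreover have "card B3 \<le> n ^ 2"
  proof (rule le[of "\<lambda>(a, b, c). (a, c)"])
    show "inj_on (\<lambda>(a, b, c). (a, c)) B3"
      by (auto simp: inj_on_def B3_def) (metis linorder_neqE_nat)
  qed (use assms(1) in \<open>auto simp: B3_def\<close>)
  moreover have "card B4 \<le> n ^ 2"
  proof (rule le[of "\<lambda>(a, b, c). (a, c)"])
    show "inj_on (\<lambda>(a, b, c). (a, c)) B4"
      by (auto simp: inj_on_def B4_def) (metis linorder_neqE_nat)
  qed (use assms(1) in \<open>auto simp: B4_def\<close>)
  moreover have "card B5 \<le> n ^ 2"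
  proof (rule le[of "\<lambda>(a, b, c). (a, b)"])
    show "inj_on (\<lambda>(a, b, c). (a, b)) B5"
      by (auto simp: inj_on_def B5_def) (metis linorder_neqE_nat)
  qed (use assms(1) in \<open>auto simp: B5_def\<close>)
  moreover have "card B6 \<le> n ^ 2"
  proof (rule le[of "\<lambda>(a, b, c). (a, b)"])
    show "inj_on (\<lambda>(a, b, c). (a, b)) B6"
      by (auto simp: inj_on_def B6_def) (metis linorder_neqE_nat)
  qed (use assms(1) in \<open>auto simp: B6_def\<close>)
  moreover have "card (B1 \<union> B2 \<union> B3 \<union> B4 \<union> B5 \<union> B6) \<le> card B1 + card B2 + card B3 + card B4 + card B5 + card B6"
    by (meson add_le_mono card_Un_le le_trans order_refl)
  ultimately have "card (B1 \<union> B2 \<union> B3 \<union> B4 \<union> B5 \<union> B6) < card A"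
    using assms(2) by linarith
  moreover have "finite A"
    using assms(1) finite_subset by blast
  moreover have "B1 \<union> B2 \<union> B3 \<union> B4 \<union> B5 \<union> B6 \<subseteq> A"
    by (auto simp: B_defs)
  ultimately have "\<not> A \<subseteq> B1 \<union> B2 \<union> B3 \<union> B4 \<union> B5 \<union> B6"
    by (metis card_mono finite_subset linorder_not_less)
  then obtain e where "e \<in> A" "e \<notin> B1" "e \<notin> B2" "e \<notin> B3" "e \<notin> B4" "e \<notin> B5" "e \<notin> B6"
    by blast
  then show ?thesis
    using that by (cases e) (simp add: B_defs, metis)
qed

lemma contains3_P_mat_minus_entry:
  assumes A: "is_mat3 A" "dim1 A = n" "dim2 A = n" "dim3 A = n" and "card (ones A) > 6 * n ^ 2"
    and e: "e \<in> ones P_mat"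
  shows "contains3 A (Mat3 2 2 2 (ones P_mat - {e}))"
proof -
  have sub: "ones A \<subseteq> {1..n} \<times> {1..n} \<times> {1..n}"
    using A by (simp add: is_mat3_def)
  obtain a b c x x' y y' z z' where lt: "x < a" "a < x'" "y < b" "b < y'" "z < c" "c < z'" and
    mem: "{(x, b, c), (x', b, c), (a, y, c), (a, y', c), (a, b, z), (a, b, z')} \<subseteq> ones A"
    using entry_with_neighbours[OF sub assms(5)] .
  have rng: "{x, a, x'} \<subseteq> {1..n}" "{y, b, y'} \<subseteq> {1..n}" "{z, c, z'} \<subseteq> {1..n}"
    using mem sub by auto
  have *: "contains3 A (Mat3 2 2 2 (ones P_mat - {e}))"
    if "u < u'" "v < v'" "w < w'" "{u, u'} \<subseteq> {1..n}" "{v, v'} \<subseteq> {1..n}" "{w, w'} \<subseteq> {1..n}"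
      "\<forall>i j k. (i, j, k) \<in> ones P_mat - {e} \<longrightarrow> (if i = 1 then u else u', if j = 1 then v else v', if k = 1 then w else w') \<in> ones A"
    for u u' v v' w w'
  proof -
    have sub222: "ones P_mat - {e} \<subseteq> {1, 2} \<times> {1, 2} \<times> {1, 2}"
      by (auto simp: P_mat_eq)
    show ?thesis
      unfolding contains3_222_iff[OF sub222] A(2-4) using that
      by (intro exI[of _ u] exI[of _ u'] exI[of _ v] exI[of _ v'] exI[of _ w] exI[of _ w'] conjI)
  qed
  consider "e = (1, 1, 2)" | "e = (1, 2, 1)" | "e = (2, 1, 1)" | "e = (2, 2, 2)"
    using e by (auto simp: P_mat_eq)
  \<comment> \<open>The centre \<open>(a, b, c)\<close> takes the corner opposite to
    \<open>e\<close>, whose three adjacent corners are the remaining entries. So where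
    \<open>e\<close> has coordinate 1 the lower neighbour is used, and where it has 2 the upper
    one.\<close>
  then show ?thesis
  proof cases
    case 1
    show ?thesis
      by (rule *[of x a y b c z']) (use 1 lt mem rng in \<open>auto simp: P_mat_eq\<close>)
  next
    case 2
    show ?thesis
      by (rule *[of x a b y' z c]) (use 2 lt mem rng in \<open>auto simp: P_mat_eq\<close>)
  next
    case 3
    show ?thesis
      by (rule *[of a x' y b z c]) (use 3 lt mem rng in \<open>auto simp: P_mat_eq\<close>)
  next
    case 4
    show ?thesis
      by (rule *[of a x' b y' c z']) (use 4 lt mem rng in \<open>auto simp: P_mat_eq\<close>)
  qed
qed

text \<open>An embedding that hits all four entries must use both indices in every direction, so it
  is the identity and \<open>P'\<close> is the pattern itself. A proper submatrix therefore misses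
  an entry \<open>e\<close>, and the same index sets embed it after \<open>e\<close> is
  deleted.\<close>

lemma properly_contained3_P_mat:
  assumes "properly_contained3 P' P_mat"
  obtains e where "e \<in> ones P_mat" "contains3 (Mat3 2 2 2 (ones P_mat - {e})) P'"
proof -
  have dims: "dim1 P_mat = 2" "dim2 P_mat = 2" "dim3 P_mat = 2"
    by (simp_all add: P_mat_eq)
  obtain U V W where *: "U \<subseteq> {1..2}" "V \<subseteq> {1..2}" "W \<subseteq> {1..2}"
    "card U = dim1 P'" "card V = dim2 P'" "card W = dim3 P'"
    "\<forall>x y z. (x, y, z) \<in> ones P' \<longrightarrow> x \<in> {1..card U} \<and> y \<in> {1..card V} \<and> z \<in> {1..card W} \<and>
        (elt U x, elt V y, elt W z) \<in> ones P_mat"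
    using assms unfolding properly_contained3_def contains3_iff dims by blast
  have fin: "finite U" "finite V" "finite W"
    using * by (auto elim: finite_subset)
  define f where "f = (\<lambda>(x, y, z). (elt U x, elt V y, elt W z))"
  have "\<exists>e \<in> ones P_mat. e \<notin> f ` ones P'"
  proof (rule ccontr)
    assume "\<not> ?thesis"
    then have P: "ones P_mat \<subseteq> f ` ones P'"
      by blast
    moreover have "f ` ones P' \<subseteq> U \<times> V \<times> W"
      using *(7) fin by (fastforce simp: f_def intro!: elt_in)
    \<comment> \<open>These three entries already show both values in every coordinate.\<close>
    ultimately have "{(1,1,2), (2,2,2), (1,2,1)} \<subseteq> U \<times> V \<times> W"
      by (auto simp: P_mat_eq)
    then have UVW: "U = {1, 2}" "V = {1, 2}" "W = {1, 2}"
      using *(1-3) by force+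
    have elt: "elt {1, 2} i = i" if "i \<in> {1..card {1, 2::nat}}" for i
    proof -
      have "sorted_list_of_set {1, 2::nat} = [1, 2]"
        by (intro strict_sorted_equal[OF _ strict_sorted_list_of_set]) auto
      moreover have "i = 1 \<or> i = 2"
        using that by auto
      ultimately show ?thesis
        by (auto simp: elt_def)
    qed
    have "f ` ones P' = id ` ones P'"
      by (rule image_cong) (use *(7) elt in \<open>auto simp: f_def UVW\<close>)
    moreover have "f ` ones P' \<subseteq> ones P_mat"
      using *(7) by (auto simp: f_def)
    ultimately have "ones P' = ones P_mat"
      using P by auto
    then have "P' = P_mat"
      using *(4-6) dims by (intro mat3.expand) (simp add: UVW)
    then show False
      using assms by (simp add: properly_contained3_def)
  qed
  then obtain e where e: "e \<in> ones P_mat" "e \<notin> f ` ones P'"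
    by blast
  have "contains3 (Mat3 2 2 2 (ones P_mat - {e})) P'"
    unfolding contains3_iff
  proof (intro exI conjI)
    show "\<forall>x y z. (x, y, z) \<in> ones P' \<longrightarrow> x \<in> {1..card U} \<and> y \<in> {1..card V} \<and> z \<in> {1..card W} \<and>
        (elt U x, elt V y, elt W z) \<in> ones (Mat3 2 2 2 (ones P_mat - {e}))"
      using *(7) e(2) by (force simp: f_def)
  qed (use * in auto)
  with e(1) show ?thesis
    using that by blast
qed

text \<open>With more than \<open>6 * n ^ 2\<close> entries every one-entry deletion of the pattern
  occurs, in particular one that contains \<open>P'\<close>.\<close>

lemma ex3_properly_contained_le:
  assumes "properly_contained3 P' P_mat"
  shows "real (ex3 n P') \<le> 6 * real n ^ 2"
proof (rule ex3_le)
  fix A assume A: "A \<in> free_mats3 n P'"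
  obtain e where "e \<in> ones P_mat" "contains3 (Mat3 2 2 2 (ones P_mat - {e})) P'"
    using properly_contained3_P_mat[OF assms] .
  then have "\<not> card (ones A) > 6 * n ^ 2"
    using A contains3_P_mat_minus_entry[of A n e] contains3_trans unfolding free_mats3_def by blast
  then have "card (ones A) \<le> 6 * n ^ 2"
    by simp
  then show "real (card (ones A)) \<le> 6 * real n ^ 2"
    by (simp flip: of_nat_le_iff[where 'a = real])
qed simp

theorem lemma3p19:
  shows "(\<lambda>n. real (ex3 n P_mat)) \<in> \<Omega>(\<lambda>n. real n powr (5/2))
       \<and> (\<lambda>n. real (ex3 n P_mat)) \<in> O(\<lambda>n. real n powr (11/4))
       \<and> minimally_non_O_n2 P_mat"
proof (intro conjI)
  show lower: "(\<lambda>n. real (ex3 n P_mat)) \<in> \<Omega>(\<lambda>n. real n powr (5/2))"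
    unfolding bigomega_iff_bigo
    by (rule bigoI[of _ 8], rule eventually_sequentiallyI[of 1]) (simp add: powr_le_ex3_P_mat)
  show "(\<lambda>n. real (ex3 n P_mat)) \<in> O(\<lambda>n. real n powr (11/4))"
    by (rule bigoI[of _ 3], rule eventually_sequentiallyI[of 1]) (simp add: ex3_P_mat_le)
  have "(\<lambda>n. real n ^ 2) \<in> o(\<lambda>n. real n powr (5/2))"
    by real_asymp
  also have "(\<lambda>n. real n powr (5/2)) \<in> O(\<lambda>n. real (ex3 n P_mat))"
    using lower by (simp add: bigomega_iff_bigo)
  finally have "(\<lambda>n. real (ex3 n P_mat)) \<in> \<omega>(\<lambda>n. real n ^ 2)"
    by (simp add: smallomega_iff_smallo)
  moreover have "(\<lambda>n. real (ex3 n P')) \<in> O(\<lambda>n. real n ^ 2)" if "properly_contained3 P' P_mat" for P'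
    by (rule bigoI[of _ 6], rule always_eventually) (simp add: ex3_properly_contained_le[OF that])
  ultimately show "minimally_non_O_n2 P_mat"
    unfolding minimally_non_O_n2_def by (auto simp: is_mat3_def P_mat_eq)
qed

end
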